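(* Let $\mathbb{K}=\mathbb{R}$ or $\mathbb{C}$, let $X$ be a first countable, Hausdorff topological vector space over $\mathbb{K}$, let $\mu$ be a non-zero measure on the Borel $\sigma$-algebra of $X$ that is finite on bounded sets, and let $K\subset X$ be a bounded, open neighbourhood of the origin. Let $E\subset X$ be topologically dense in $X$, let $u\in\operatorname{supp}(\mu)$, and suppose that there exists $(v^{\ast},r^{\ast})\in E\times(0,1)$ such that, for all $\rho\in\mathbb{K}$ with $0<|\rho|<r^{\ast}$, $$\phi(u-v^{\ast},\rho)=\sup_{z\in u-E}\phi(z,\rho).$$ Then $u$ is an $E$-weak mode of $\mu$ if and only if $u$ is a strong mode of $\mu$, where both notions are taken with respect to scaling factors $\rho\in\mathbb{K}\setminus\{0\}$.
   Context: For $x\in X$ and $\rho\in\mathbb{K}\setminus\{0\}$, put $\phi(x,\rho)=\mu(x+\rho K)\in[0,\infty)$. For $E\subset X$, $u-E=\{u-v: v\in E\}$. $\operatorname{supp}(\mu)$ is the set of points all of whose open neighbourhoods have positive $\mu$-measure. Limits as $|\rho|\to0$ are over $\rho\in\mathbb{K}\setminus\{0\}$. Suprema take values in $[0,\infty]$. A strong mode of $\mu$ (with scaling factors in $\mathbb{K}\setminus\{0\}$) is any $u\in X$ such that $\lim_{|\rho|\to0}\frac{\sup_{z\in X}\phi(z,\rho)}{\phi(u,\rho)}=1$. An $E$-weak mode of $\mu$ (with scaling factors in $\mathbb{K}\setminus\{0\}$) is any $u\in\operatorname{supp}(\mu)$ such that $\limsup_{|\rho|\to0}\frac{\phi(u-v,\rho)}{\phi(u,\rho)}\le1$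 for every $v\in E$. *)

theory Defs
  imports "HOL-Analysis.Analysis"
begin

text \<open>
  The scalar field is \<open>\<real>\<close> or \<open>\<complex>\<close>. Multiplicativity of the norm in \<^class>\<open>real_normed_field\<close>
  forces the norm of a type in the following class to be the usual absolute value.
\<close>

class real_or_complex_field = real_normed_field +
  assumes real_or_complex:
    "(\<forall>z. \<exists>a. z = a *\<^sub>R 1) \<or>
     (\<exists>i. i * i = - 1 \<and> (\<forall>z. \<exists>a b. z = a *\<^sub>R 1 + b *\<^sub>R i))"

instance real :: real_or_complex_field
  by standard auto

instance complex :: real_or_complex_field
proof
  have "z = Re z *\<^sub>R 1 + Im z *\<^sub>R \<i>" for z :: complex
    by (simp add: complex_eq_iff)
  then show "(\<forall>z::complex. \<exists>a. z = a *\<^sub>R 1) \<or>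
     (\<exists>i::complex. i * i = - 1 \<and> (\<forall>z. \<exists>a b. z = a *\<^sub>R 1 + b *\<^sub>R i))"
    using i_squared by blast
qed

text \<open>Continuity of addition and negation is part of \<^class>\<open>topological_ab_group_add\<close>.\<close>

locale topological_vector_space = vector_space smul
  for smul :: "'k::real_or_complex_field \<Rightarrow> 'x::topological_ab_group_add \<Rightarrow> 'x" +
  assumes continuous_smul: "continuous_on UNIV (\<lambda>(a, x). smul a x)"

text \<open>Boundedness in the sense of von Neumann: absorbed by every neighbourhood of the origin.\<close>

definition tvs_bounded ::
    "('k::real_or_complex_field \<Rightarrow> 'x::topological_ab_group_add \<Rightarrow> 'x) \<Rightarrow> 'x set \<Rightarrow> bool" where
  "tvs_bounded smul B \<longleftrightarrow>
     (\<forall>U. open U \<longrightarrow> 0 \<in> U \<longrightarrow> (\<exists>s>0. \<forall>t. norm t > s \<longrightarrow> B \<subseteq> smul t ` U))"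

definition measure_supp :: "'x::topological_space measure \<Rightarrow> 'x set" where
  "measure_supp \<mu> = {x. \<forall>U. open U \<longrightarrow> x \<in> U \<longrightarrow> emeasure \<mu> U > 0}"

definition phi ::
    "('k::real_or_complex_field \<Rightarrow> 'x::topological_ab_group_add \<Rightarrow> 'x) \<Rightarrow> 'x measure \<Rightarrow> 'x set
       \<Rightarrow> 'x \<Rightarrow> 'k \<Rightarrow> ennreal" where
  "phi smul \<mu> K x \<rho> = emeasure \<mu> ((\<lambda>k. x + smul \<rho> k) ` K)"

text \<open>
  The filter \<open>at 0\<close> on the scalars excludes \<open>0\<close> itself, so it expresses
  \<open>|\<rho>| \<rightarrow> 0\<close> over nonzero scalars. The quotients are taken in \<^typ>\<open>ennreal\<close>; for \<open>u\<close> in the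
  support and \<open>\<rho> \<noteq> 0\<close> their denominator is positive, and it is finite if the measure is
  finite on bounded sets and \<open>K\<close> is bounded.
\<close>

definition strong_mode ::
    "('k::real_or_complex_field \<Rightarrow> 'x::topological_ab_group_add \<Rightarrow> 'x) \<Rightarrow> 'x measure \<Rightarrow> 'x set
       \<Rightarrow> 'x \<Rightarrow> bool" where
  "strong_mode smul \<mu> K u \<longleftrightarrow>
     ((\<lambda>\<rho>. (SUP z. phi smul \<mu> K z \<rho>) / phi smul \<mu> K u \<rho>) \<longlongrightarrow> 1) (at 0)"

definition weak_mode ::
    "('k::real_or_complex_field \<Rightarrow> 'x::topological_ab_group_add \<Rightarrow> 'x) \<Rightarrow> 'x measure \<Rightarrow> 'x set
       \<Rightarrow> 'x set \<Rightarrow> 'x \<Rightarrow> bool" where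
  "weak_mode smul \<mu> K E u \<longleftrightarrow>
     u \<in> measure_supp \<mu> \<and>
     (\<forall>v\<in>E. Limsup (at 0) (\<lambda>\<rho>. phi smul \<mu> K (u - v) \<rho> / phi smul \<mu> K u \<rho>) \<le> 1)"

end

theory Submission
  imports Defs
begin

text \<open>
  The hypothesis only controls the small balls centred on the dense set \<open>u - E\<close>, while a strong mode
  compares \<open>u\<close> with all of \<open>X\<close>. The two suprema agree, because \<open>K\<close> is open: if \<open>x\<^sub>n \<longlongrightarrow> x\<close>, every
  point of \<open>x + \<rho>K\<close> lies in \<open>x\<^sub>n + \<rho>K\<close> for all large \<open>n\<close>, so \<open>\<phi>(\<cdot>, \<rho>)\<close> is sequentially lower
  semicontinuous (Fatou's lemma for sets), and first countability lets every \<open>x\<close> be reached by a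
  sequence in \<open>u - E\<close> (\<open>SUP_phi_dense\<close>).

  Hence \<open>\<phi>(u - v\<^sup>*, \<rho>)\<close> is the global supremum \<open>M(\<rho>)\<close> for small \<open>\<rho>\<close>. The quotient
  \<open>M(\<rho>) / \<phi>(u, \<rho>)\<close> dominates \<open>\<phi>(u - v, \<rho>) / \<phi>(u, \<rho>)\<close> for every \<open>v\<close>, so a strong mode is a weak
  mode. Conversely, the weak mode condition for the single direction \<open>v\<^sup>*\<close> bounds the upper limit of
  \<open>M(\<rho>) / \<phi>(u, \<rho>)\<close> by \<open>1\<close>, and this quotient is at least \<open>1\<close> as soon as \<open>\<phi>(u, \<rho>)\<close> is neither \<open>0\<close>
  (because \<open>u\<close> is in the support) nor infinite (because \<open>u + \<rho>K\<close> is bounded).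
\<close>

context topological_vector_space
begin

lemma tendsto_smul:
  assumes "(f \<longlongrightarrow> a) F" and "(g \<longlongrightarrow> x) F"
  shows "((\<lambda>i. smul (f i) (g i)) \<longlongrightarrow> smul a x) F"
  using continuous_on_tendsto_compose[OF continuous_smul tendsto_Pair[OF assms]] by simp

lemma affine_image_eq_vimage:
  assumes "\<rho> \<noteq> 0"
  shows "(\<lambda>k. x + smul \<rho> k) ` K = (\<lambda>y. smul (inverse \<rho>) (y - x)) -` K"
proof (intro set_eqI iffI)
  fix y assume "y \<in> (\<lambda>y. smul (inverse \<rho>) (y - x)) -` K"
  moreover have "y = x + smul \<rho> (smul (inverse \<rho>) (y - x))"
    using assms by simp
  ultimately show "y \<in> (\<lambda>k. x + smul \<rho> k) ` K" by blast
qed (use assms in auto)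

lemma open_affine_image:
  assumes "open K" and "\<rho> \<noteq> 0"
  shows "open ((\<lambda>k. x + smul \<rho> k) ` K)"
proof -
  have "continuous_on UNIV (\<lambda>y. smul (inverse \<rho>) (y - x))"
    unfolding continuous_on_def by (intro ballI tendsto_smul tendsto_intros)
  with \<open>open K\<close> show ?thesis
    unfolding affine_image_eq_vimage[OF \<open>\<rho> \<noteq> 0\<close>] by (rule open_vimage)
qed

text \<open>
  To absorb \<open>x + \<rho>B\<close> into \<open>tU\<close>, choose neighbourhoods \<open>V\<close> and \<open>W\<close> of \<open>0\<close> with \<open>V + W \<subseteq> U\<close> (below,
  \<open>V\<close> is the set of points satisfying \<open>P\<close>). For large \<open>\<bar>t\<bar>\<close>, the set \<open>tV\<close> contains \<open>x\<close> since
  \<open>t\<^sup>-\<^sup>1 x\<close> tends to \<open>0\<close> as \<open>\<bar>t\<bar>\<close> tends to infinity, and \<open>tW\<close> contains \<open>\<rho>B\<close> since \<open>(t / \<rho>)W\<close>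
  contains \<open>B\<close>.
\<close>

lemma tvs_bounded_affine_image:
  assumes B: "tvs_bounded smul B" and "\<rho> \<noteq> 0"
  shows "tvs_bounded smul ((\<lambda>k. x + smul \<rho> k) ` B)"
  unfolding tvs_bounded_def
proof (intro allI impI)
  fix U :: "'x set" assume U: "open U" "0 \<in> U"
  have "((\<lambda>p. fst p + snd p) \<longlongrightarrow> (0::'x) + 0) (nhds 0 \<times>\<^sub>F nhds 0)"
    by (rule tendsto_add_Pair)
  then have "\<forall>\<^sub>F p in nhds 0 \<times>\<^sub>F nhds 0. fst p + snd p \<in> U"
    using U by (auto dest: topological_tendstoD)
  then obtain P Q where PQ: "eventually P (nhds (0::'x))" "eventually Q (nhds 0)"
      "\<And>v w. P v \<Longrightarrow> Q w \<Longrightarrow> v + w \<in> U"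
    unfolding eventually_prod_filter by auto
  from PQ(2) obtain W where W: "open W" "0 \<in> W" "\<And>w. w \<in> W \<Longrightarrow> Q w"
    unfolding eventually_nhds by blast
  from B W obtain s where s: "s > 0" "\<And>t. norm t > s \<Longrightarrow> B \<subseteq> smul t ` W"
    unfolding tvs_bounded_def by blast
  have "((\<lambda>t. smul (inverse t) x) \<longlongrightarrow> smul 0 x) at_infinity"
    by (intro tendsto_smul tendsto_inverse_0 tendsto_const)
  with PQ(1) have "\<forall>\<^sub>F t in at_infinity. P (smul (inverse t) x)"
    unfolding filterlim_iff by simp
  then obtain r where r: "\<And>t. norm t \<ge> r \<Longrightarrow> P (smul (inverse t) x)"
    unfolding eventually_at_infinity by blast
  let ?s = "max r (s * norm \<rho>)"
  have "(\<lambda>k. x + smul \<rho> k) ` B \<subseteq> smul t ` U" if t: "norm t > ?s" for t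
  proof safe
    fix k assume k: "k \<in> B"
    have "s * norm \<rho> > 0" using s(1) \<open>\<rho> \<noteq> 0\<close> by simp
    with t have "t \<noteq> 0" by auto
    have "norm (t / \<rho>) > s"
      using t \<open>\<rho> \<noteq> 0\<close> by (simp add: norm_divide field_simps)
    with k s(2) obtain w where w: "w \<in> W" "k = smul (t / \<rho>) w" by blast
    have "x + smul \<rho> k = smul t (smul (inverse t) x + w)"
      using \<open>t \<noteq> 0\<close> \<open>\<rho> \<noteq> 0\<close> by (simp add: w(2) scale_right_distrib)
    moreover have "smul (inverse t) x + w \<in> U"
      using r[of t] t PQ(3) W(3)[OF w(1)] by simp
    ultimately show "x + smul \<rho> k \<in> smul t ` U" by blast
  qed
  moreover have "?s > 0"
    using s(1) \<open>\<rho> \<noteq> 0\<close> by (simp add: less_max_iff_disj)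
  ultimately show "\<exists>s>0. \<forall>t. norm t > s \<longrightarrow> (\<lambda>k. x + smul \<rho> k) ` B \<subseteq> smul t ` U"
    by blast
qed

text \<open>
  The sets \<open>C n = \<Inter>m\<ge>n. (X m + \<rho>K)\<close> increase, and their union contains \<open>x + \<rho>K\<close> because \<open>K\<close> is
  open. Continuity from below gives Fatou's inequality for these sets.
\<close>

lemma phi_le_of_tendsto:
  assumes sets: "sets \<mu> = sets borel" and "open K" and "\<rho> \<noteq> 0"
    and lim: "X \<longlonglongrightarrow> x" and le: "\<And>n. phi smul \<mu> K (X n) \<rho> \<le> c"
  shows "phi smul \<mu> K x \<rho> \<le> c"
proof -
  define A where "A y = (\<lambda>k. y + smul \<rho> k) ` K" for y
  define C where "C n = (\<Inter>m\<in>{n..}. A (X m))" for n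
  have A[measurable]: "A y \<in> sets \<mu>" for y
    using open_affine_image[OF \<open>open K\<close> \<open>\<rho> \<noteq> 0\<close>] by (simp add: sets A_def)
  have C: "C n \<in> sets \<mu>" for n
    unfolding C_def by (rule sets.countable_INT') auto
  have "A x \<subseteq> (\<Union>n. C n)"
  proof
    fix y assume "y \<in> A x"
    then have "smul (inverse \<rho>) (y - x) \<in> K"
      by (simp add: A_def affine_image_eq_vimage[OF \<open>\<rho> \<noteq> 0\<close>])
    moreover have "(\<lambda>n. smul (inverse \<rho>) (y - X n)) \<longlonglongrightarrow> smul (inverse \<rho>) (y - x)"
      by (intro tendsto_smul tendsto_intros lim)
    ultimately have "\<forall>\<^sub>F n in sequentially. smul (inverse \<rho>) (y - X n) \<in> K"
      using \<open>open K\<close> by (blast dest: topological_tendstoD)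
    then show "y \<in> (\<Union>n. C n)"
      by (auto simp: C_def A_def affine_image_eq_vimage[OF \<open>\<rho> \<noteq> 0\<close>] eventually_sequentially)
  qed
  then have "emeasure \<mu> (A x) \<le> emeasure \<mu> (\<Union>n. C n)"
    using C by (intro emeasure_mono) auto
  also have "\<dots> = (SUP n. emeasure \<mu> (C n))"
    using C by (intro SUP_emeasure_incseq[symmetric]) (auto simp: incseq_def C_def)
  also have "\<dots> \<le> c"
  proof (rule SUP_least)
    fix n
    have "emeasure \<mu> (C n) \<le> emeasure \<mu> (A (X n))"
      by (rule emeasure_mono) (auto simp: C_def)
    also have "\<dots> \<le> c" using le by (simp add: phi_def A_def)
    finally show "emeasure \<mu> (C n) \<le> c" .
  qed
  finally show ?thesis by (simp add: phi_def A_def)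
qed

end

text \<open>
  First countability is what makes sequences in \<open>E\<close>, rather than nets, reach every point; Fatou's
  inequality above is specific to sequences.
\<close>

lemma SUP_phi_dense:
  fixes smul :: "'k::real_or_complex_field \<Rightarrow>
      'x::{topological_ab_group_add, first_countable_topology} \<Rightarrow> 'x"
  assumes "topological_vector_space smul"
    and "sets \<mu> = sets borel" and "open K" and "\<rho> \<noteq> 0"
    and dense: "closure E = UNIV"
  shows "(SUP z\<in>(\<lambda>w. u - w) ` E. phi smul \<mu> K z \<rho>) = (SUP z. phi smul \<mu> K z \<rho>)"
    (is "?S = _")
proof (rule antisym)
  interpret topological_vector_space smul by fact
  show "(SUP z. phi smul \<mu> K z \<rho>) \<le> ?S"
  proof (rule SUP_least)
    fix x
    have "u - x \<in> closure E" using dense by simp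
    then obtain e where e: "\<And>n. e n \<in> E" "e \<longlonglongrightarrow> u - x"
      unfolding closure_sequential by blast
    have "(\<lambda>n. u - e n) \<longlonglongrightarrow> u - (u - x)"
      by (intro tendsto_intros e)
    then have "(\<lambda>n. u - e n) \<longlonglongrightarrow> x" by simp
    then show "phi smul \<mu> K x \<rho> \<le> ?S"
      by (rule phi_le_of_tendsto[OF assms(2-4)]) (auto intro!: SUP_upper e)
  qed
qed (rule SUP_subset_mono, simp_all)

text \<open>Positivity and finiteness together exclude the degenerate quotients of \<^typ>\<open>ennreal\<close>.\<close>

lemma (in topological_vector_space) phi_pos:
  assumes "open K" and "0 \<in> K" and "\<rho> \<noteq> 0" and "u \<in> measure_supp \<mu>"
  shows "phi smul \<mu> K u \<rho> > 0"
proof -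
  have "u \<in> (\<lambda>k. u + smul \<rho> k) ` K"
    using \<open>0 \<in> K\<close> by (intro image_eqI[of _ _ 0]) simp_all
  then show ?thesis
    using assms open_affine_image[of K \<rho> u] by (auto simp: phi_def measure_supp_def)
qed

lemma (in topological_vector_space) phi_finite:
  assumes "\<And>B. B \<in> sets borel \<Longrightarrow> tvs_bounded smul B \<Longrightarrow> emeasure \<mu> B < \<infinity>"
    and "open K" and "tvs_bounded smul K" and "\<rho> \<noteq> 0"
  shows "phi smul \<mu> K u \<rho> < \<infinity>"
  unfolding phi_def
  by (intro assms(1) borel_open open_affine_image tvs_bounded_affine_image assms)

theorem theorem5p2:
  fixes smul :: "'k::real_or_complex_field \<Rightarrow>
      'x::{topological_ab_group_add, first_countable_topology, t2_space} \<Rightarrow> 'x"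
    and \<mu> :: "'x measure"
    and K E :: "'x set"
    and u :: 'x
  assumes "topological_vector_space smul"
    and "sets \<mu> = sets borel"
    and "emeasure \<mu> UNIV \<noteq> 0"
    and "\<And>B. B \<in> sets borel \<Longrightarrow> tvs_bounded smul B \<Longrightarrow> emeasure \<mu> B < \<infinity>"
    and "open K" and "0 \<in> K" and "tvs_bounded smul K"
    and "closure E = UNIV"
    and "u \<in> measure_supp \<mu>"
    and "\<exists>v\<in>E. \<exists>r. 0 < r \<and> r < 1 \<and>
           (\<forall>\<rho>::'k. 0 < norm \<rho> \<and> norm \<rho> < r \<longrightarrow>
              phi smul \<mu> K (u - v) \<rho> = (SUP z\<in>(\<lambda>w. u - w) ` E. phi smul \<mu> K z \<rho>))"
  shows "weak_mode smul \<mu> K E u \<longleftrightarrow> strong_mode smul \<mu> K u"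
proof
  interpret topological_vector_space smul by fact
  let ?M = "\<lambda>\<rho>. SUP z. phi smul \<mu> K z \<rho>"
  let ?q = "\<lambda>\<rho>. ?M \<rho> / phi smul \<mu> K u \<rho>"
  {
    assume "strong_mode smul \<mu> K u"
    then have "Limsup (at 0) ?q = 1"
      unfolding strong_mode_def by (intro lim_imp_Limsup) auto
    moreover have "Limsup (at 0) (\<lambda>\<rho>. phi smul \<mu> K (u - v) \<rho> / phi smul \<mu> K u \<rho>)
        \<le> Limsup (at 0) ?q" for v
      by (intro Limsup_mono always_eventually allI divide_right_mono_ennreal SUP_upper) simp
    ultimately show "weak_mode smul \<mu> K E u"
      using \<open>u \<in> measure_supp \<mu>\<close> by (simp add: weak_mode_def)
  next
    assume weak: "weak_mode smul \<mu> K E u"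
    from assms(10) obtain v r where v: "v \<in> E" and r: "0 < r"
      "\<And>\<rho>. \<lbrakk>0 < norm \<rho>; norm \<rho> < r\<rbrakk> \<Longrightarrow>
        phi smul \<mu> K (u - v) \<rho> = (SUP z\<in>(\<lambda>w. u - w) ` E. phi smul \<mu> K z \<rho>)"
      by blast
    have "\<forall>\<^sub>F \<rho> in at 0. phi smul \<mu> K (u - v) \<rho> / phi smul \<mu> K u \<rho> = ?q \<rho>"
      unfolding eventually_at
      using r SUP_phi_dense[OF assms(1,2,5) _ assms(8)] by (intro exI[of _ r]) simp
    then have "Limsup (at 0) (\<lambda>\<rho>. phi smul \<mu> K (u - v) \<rho> / phi smul \<mu> K u \<rho>) = Limsup (at 0) ?q"
      by (rule Limsup_eq)
    with weak v have upper: "Limsup (at 0) ?q \<le> 1"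
      unfolding weak_mode_def by metis
    have "1 \<le> ?q \<rho>" if "\<rho> \<noteq> 0" for \<rho>
    proof -
      have "phi smul \<mu> K u \<rho> \<noteq> 0" "phi smul \<mu> K u \<rho> \<noteq> \<infinity>"
        using phi_pos[OF assms(5,6) that assms(9)] phi_finite[OF assms(4,5,7) that, of u] by auto
      then have "1 = phi smul \<mu> K u \<rho> / phi smul \<mu> K u \<rho>"
        by (simp add: ennreal_divide_self less_top)
      also have "\<dots> \<le> ?q \<rho>"
        by (intro divide_right_mono_ennreal SUP_upper) simp
      finally show ?thesis .
    qed
    then have "1 \<le> Liminf (at 0) ?q"
      by (intro Liminf_bounded) (simp add: eventually_at_filter)
    moreover have "Liminf (at 0) ?q \<le> Limsup (at 0) ?q"
      by (rule Liminf_le_Limsup) simp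
    ultimately show "strong_mode smul \<mu> K u"
      using upper unfolding strong_mode_def by (intro Liminf_eq_Limsup antisym) auto
  }
qed

end
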